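(* Let $n$ be a positive integer. Real orthogonal $n \times n \times n$ tensors exist only for $n = 1,2,4,8$. Consequently, \[ \operatorname{App}_3(\mathbb{R};n,n,n) = \frac{1}{n} \] if and only if $n \in\{ 1,2,4,8\}$. Otherwise, the value of $\operatorname{App}_3(\mathbb{R};n,n,n)$ is strictly larger than $1/n$.
   Context: Orthogonal tensors: a vector is orthogonal if its Euclidean norm is one; for $n_1\le\dots\le n_d$, $d\ge2$, a real tensor $\mathbf{X}\in\mathbb{R}^{n_1\times\dots\times n_d}$ is orthogonal if for every unit vector $u\in\mathbb{R}^{n_1}$ the order-$(d-1)$ tensor $\mathbf{X}\times_1u$ with entries $\sum_{i}u(i)\mathbf{X}(i,i_2,\dots,i_d)$ is orthogonal. The Frobenius norm $\|\mathbf{X}\|_F$ of $\mathbf{X}\in\mathbb{R}^{n\times n\times n}$ is the Euclidean norm of the array of entries, with inner product $\langle\mathbf{X},\mathbf{Y}\rangle_F=\sum\mathbf{X}(i,j,k)\mathbf{Y}(i,j,k)$; the spectral norm is $\|\mathbf{X}\|_2=\max\{|\langle\mathbf{X},u\otimes v\otimes w\rangle_F|: u,v,w\in\mathbb{R}^n,\ \|u\|=\|v\|=\|w\|=1\}$, where $u\otimes v\otimes w$ has entries $u_iv_jw_k$; and $\operatorname{App}_3(\mathbb{R};n,n,n)=\min_{0\ne\mathbf{X}\in\mathbb{R}^{n\times n\times n}}\|\mathbf{X}\|_2/\|\mathbf{X}\|_F$. *)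

theory Defs
  imports "HOL-Analysis.Analysis"
begin

text \<open>
  A real tensor of size \<open>n \<times> m \<times> p\<close> is an element \<open>X\<close> of \<^typ>\<open>real^'p^'m^'n\<close> (note the reversed
  order of the index types) with entries \<open>X $ i $ j $ k\<close>. The library's \<^const>\<open>norm\<close> and
  \<^const>\<open>inner\<close> on this type are the Frobenius norm and the Frobenius inner product.
\<close>

definition contract1 :: "'b::real_vector ^ 'n \<Rightarrow> real ^ 'n \<Rightarrow> 'b"  (infixl "\<times>\<^sub>1" 75)
  where "X \<times>\<^sub>1 u = (\<Sum>i\<in>UNIV. u $ i *\<^sub>R X $ i)"

text \<open>
  Orthogonality is defined by recursion on the order of the tensor; the order is part of the type,
  so the recursion is written out up to order three. The dimensions are meant to be weakly
  increasing, as is the case for cubical tensors.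
\<close>

definition orthogonal_tensor1 :: "real^'n \<Rightarrow> bool"
  where "orthogonal_tensor1 x \<longleftrightarrow> norm x = 1"

definition orthogonal_tensor2 :: "real^'m^'n \<Rightarrow> bool"
  where "orthogonal_tensor2 X \<longleftrightarrow> (\<forall>u. norm u = 1 \<longrightarrow> orthogonal_tensor1 (X \<times>\<^sub>1 u))"

definition orthogonal_tensor3 :: "real^'p^'m^'n \<Rightarrow> bool"
  where "orthogonal_tensor3 X \<longleftrightarrow> (\<forall>u. norm u = 1 \<longrightarrow> orthogonal_tensor2 (X \<times>\<^sub>1 u))"

definition outer3 :: "real^'n \<Rightarrow> real^'m \<Rightarrow> real^'p \<Rightarrow> real^'p^'m^'n"
  where "outer3 u v w = (\<chi> i j k. u $ i * v $ j * w $ k)"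

text \<open>
  The maximum in the spectral norm and the minimum in \<open>App3\<close> are written as \<^const>\<open>Sup\<close> and
  \<^const>\<open>Inf\<close>; the lemmas \<open>spectral_norm_attained\<close> and \<open>App3_attained\<close> below show that both are
  attained.
\<close>

definition spectral_norm :: "real^'n^'n^'n \<Rightarrow> real"
  where "spectral_norm X =
    Sup {\<bar>X \<bullet> outer3 u v w\<bar> | u v w. norm u = 1 \<and> norm v = 1 \<and> norm w = 1}"

definition App3 :: "'n::finite itself \<Rightarrow> real"
  where "App3 (_ :: 'n itself) = Inf {spectral_norm X / norm X | X :: real^'n^'n^'n. X \<noteq> 0}"

lemma contract1_tensor3_component:
  fixes X :: "real^'p^'m^'n"
  shows "(X \<times>\<^sub>1 u) $ j $ k = (\<Sum>i\<in>UNIV. u $ i * X $ i $ j $ k)"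
  by (simp add: contract1_def)

lemma inner_tensor3:
  fixes X Y :: "real^'p^'m^'n"
  shows "X \<bullet> Y = (\<Sum>i\<in>UNIV. \<Sum>j\<in>UNIV. \<Sum>k\<in>UNIV. X $ i $ j $ k * Y $ i $ j $ k)"
  by (simp add: inner_vec_def)

lemma norm_vec_scaleR_const:
  fixes M :: "'b::real_normed_vector"
  shows "norm (\<chi> i. u $ i *\<^sub>R M) = norm (u :: real^'n) * norm M"
  by (simp add: norm_vec_def L2_set_def power_mult_distrib flip: sum_distrib_right)
     (simp add: real_sqrt_mult)

lemma norm_outer3: "norm (outer3 u v w) = norm u * norm v * norm w"
proof -
  have "outer3 u v w = (\<chi> i. u $ i *\<^sub>R (\<chi> j. v $ j *\<^sub>R w))"
    by (simp add: outer3_def vec_eq_iff)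
  then show ?thesis by (simp add: norm_vec_scaleR_const)
qed

lemma spectral_norm_is_max:
  fixes X :: "real^'n^'n^'n"
  shows "\<exists>u v w. norm u = 1 \<and> norm v = 1 \<and> norm w = 1 \<and> spectral_norm X = \<bar>X \<bullet> outer3 u v w\<bar>"
    and "norm u = 1 \<Longrightarrow> norm v = 1 \<Longrightarrow> norm w = 1 \<Longrightarrow> \<bar>X \<bullet> outer3 u v w\<bar> \<le> spectral_norm X"
proof -
  let ?S = "sphere (0::real^'n) 1"
  let ?f = "\<lambda>(u, v, w). \<bar>X \<bullet> outer3 u v w\<bar>"
  let ?A = "{\<bar>X \<bullet> outer3 u v w\<bar> | u v w. norm u = 1 \<and> norm v = 1 \<and> norm w = 1}"
  have "continuous_on (?S \<times> ?S \<times> ?S) ?f"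
    by (simp add: inner_tensor3 outer3_def case_prod_unfold) (intro continuous_intros)
  then have "compact (?f ` (?S \<times> ?S \<times> ?S))"
    by (intro compact_continuous_image compact_Times) auto
  moreover have A: "?A = ?f ` (?S \<times> ?S \<times> ?S)"
    by (force simp: image_def)
  ultimately have c: "compact ?A" by simp
  obtain e :: "real^'n" where "norm e = 1" using vector_choose_size[of 1] by auto
  then have "?A \<noteq> {}" by blast
  then have "Sup ?A \<in> ?A"
    using c by (intro closed_contains_Sup compact_imp_closed bounded_imp_bdd_above compact_imp_bounded)
  then show "\<exists>u v w. norm u = 1 \<and> norm v = 1 \<and> norm w = 1 \<and> spectral_norm X = \<bar>X \<bullet> outer3 u v w\<bar>"
    unfolding spectral_norm_def by blast
  show "\<bar>X \<bullet> outer3 u v w\<bar> \<le> spectral_norm X" if "norm u = 1" "norm v = 1" "norm w = 1"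
    unfolding spectral_norm_def using that c
    by (intro cSup_upper bounded_imp_bdd_above compact_imp_bounded) auto
qed

lemmas spectral_norm_attained = spectral_norm_is_max(1)
lemmas spectral_norm_upper = spectral_norm_is_max(2)

lemma spectral_norm_diff_le:
  fixes X Y :: "real^'n^'n^'n"
  shows "spectral_norm X - spectral_norm Y \<le> norm (X - Y)"
proof -
  obtain u v w where n: "norm u = 1" "norm v = 1" "norm w = 1"
    and X: "spectral_norm X = \<bar>X \<bullet> outer3 u v w\<bar>"
    using spectral_norm_attained[of X] by blast
  have "\<bar>Y \<bullet> outer3 u v w\<bar> \<le> spectral_norm Y" by (rule spectral_norm_upper[OF n])
  moreover have "\<bar>(X - Y) \<bullet> outer3 u v w\<bar> \<le> norm (X - Y)"
    using Cauchy_Schwarz_ineq2[of "X - Y" "outer3 u v w"] n by (simp add: norm_outer3)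
  ultimately show ?thesis unfolding X by (simp add: inner_diff_left)
qed

lemma continuous_on_spectral_norm: "continuous_on S (spectral_norm :: real^'n^'n^'n \<Rightarrow> real)"
proof (rule continuous_on_iff[THEN iffD2], intro ballI allI impI)
  fix X :: "real^'n^'n^'n" and e :: real
  assume "0 < e"
  have "dist (spectral_norm Y) (spectral_norm X) \<le> dist Y X" for Y
    using spectral_norm_diff_le[of X Y] spectral_norm_diff_le[of Y X]
    by (simp add: dist_norm norm_minus_commute abs_le_iff)
  with \<open>0 < e\<close> show "\<exists>d>0. \<forall>Y\<in>S. dist Y X < d \<longrightarrow> dist (spectral_norm Y) (spectral_norm X) < e"
    by (meson le_less_trans)
qed

lemma spectral_norm_scaleR:
  fixes X :: "real^'n^'n^'n"
  assumes "c > 0"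
  shows "spectral_norm (c *\<^sub>R X) = c * spectral_norm X"
proof (rule antisym)
  obtain u v w where n: "norm u = 1" "norm v = 1" "norm w = 1"
    and X: "spectral_norm (c *\<^sub>R X) = \<bar>(c *\<^sub>R X) \<bullet> outer3 u v w\<bar>"
    using spectral_norm_attained by blast
  show "spectral_norm (c *\<^sub>R X) \<le> c * spectral_norm X"
    using spectral_norm_upper[OF n, of X] assms unfolding X by (simp add: abs_mult)
next
  obtain u v w where n: "norm u = 1" "norm v = 1" "norm w = 1"
    and X: "spectral_norm X = \<bar>X \<bullet> outer3 u v w\<bar>"
    using spectral_norm_attained by blast
  show "c * spectral_norm X \<le> spectral_norm (c *\<^sub>R X)"
    using spectral_norm_upper[OF n, of "c *\<^sub>R X"] assms unfolding X by (simp add: abs_mult)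
qed

lemma App3_is_min:
  shows "\<exists>X :: real^'n^'n^'n. X \<noteq> 0 \<and> App3 TYPE('n) = spectral_norm X / norm X"
    and "(Y :: real^'n^'n^'n) \<noteq> 0 \<Longrightarrow> App3 TYPE('n) \<le> spectral_norm Y / norm Y"
proof -
  let ?A = "{spectral_norm X / norm X | X :: real^'n^'n^'n. X \<noteq> 0}"
  have "?A = spectral_norm ` sphere (0 :: real^'n^'n^'n) 1"
  proof (intro equalityI subsetI)
    fix r assume "r \<in> ?A"
    then obtain X :: "real^'n^'n^'n" where X: "X \<noteq> 0" "r = spectral_norm X / norm X" by blast
    then have "r = spectral_norm ((1 / norm X) *\<^sub>R X)"
      by (subst spectral_norm_scaleR) auto
    moreover have "(1 / norm X) *\<^sub>R X \<in> sphere 0 1" using X by simp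
    ultimately show "r \<in> spectral_norm ` sphere (0 :: real^'n^'n^'n) 1" by (rule image_eqI)
  next
    fix r assume "r \<in> spectral_norm ` sphere (0 :: real^'n^'n^'n) 1"
    then obtain X :: "real^'n^'n^'n" where X: "norm X = 1" "r = spectral_norm X" by auto
    then have "r = spectral_norm X / norm X" "X \<noteq> 0" by auto
    then show "r \<in> ?A" by blast
  qed
  moreover have "compact (spectral_norm ` sphere (0 :: real^'n^'n^'n) 1)"
    by (intro compact_continuous_image continuous_on_spectral_norm) auto
  ultimately have c: "compact ?A" by simp
  obtain e :: "real^'n^'n^'n" where "norm e = 1" using vector_choose_size[of 1] by auto
  then have "e \<noteq> 0" by auto
  then have "?A \<noteq> {}" by blast
  then have "Inf ?A \<in> ?A"
    using c by (intro closed_contains_Inf compact_imp_closed bounded_imp_bdd_below compact_imp_bounded)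
  then show "\<exists>X :: real^'n^'n^'n. X \<noteq> 0 \<and> App3 TYPE('n) = spectral_norm X / norm X"
    unfolding App3_def by blast
  show "App3 TYPE('n) \<le> spectral_norm Y / norm Y" if "(Y :: real^'n^'n^'n) \<noteq> 0"
    unfolding App3_def using that c
    by (intro cInf_lower bounded_imp_bdd_below compact_imp_bounded) auto
qed

lemmas App3_attained = App3_is_min(1)
lemmas App3_lower = App3_is_min(2)

end

theory Submission
  imports Defs
begin

text \<open>
  A tensor \<open>X\<close> of size \<open>n \<times> n \<times> n\<close> is the same thing as the bilinear map \<open>(u, v) \<mapsto> X \<times>\<^sub>1 u \<times>\<^sub>1 v\<close> on
  \<open>\<real>\<^sup>n\<close>, and it is orthogonal exactly when this map is multiplicative for the Euclidean norm. So the
  first claim is Hurwitz's theorem on compositions of quadratic forms.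

  Twisting such a map by the inverses of left and right multiplication by a fixed unit vector
  produces a unit element (\<open>composition_imp_unital\<close>). In a unital composition algebra, let \<open>B\<close> be a
  proper subalgebra and \<open>i\<close> a unit vector orthogonal to it. Then \<open>B + B i\<close> is a subalgebra of twice
  the dimension whose product is dictated by the Cayley-Dickson formula
  \<open>(a + b i)(c + d i) = (a c - d\<^sup>* b) + (d a + b c\<^sup>* ) i\<close> (\<open>double_subalgebra\<close>, \<open>dim_double\<close>). Each
  doubling costs a law: a proper subalgebra is associative (\<open>normal_imp_associative\<close>), what was
  doubled to an associative algebra is commutative, and what was doubled to a commutative one has
  trivial conjugation. Starting from the real line, the dimensions are 1, 2, 4, 8; a fourth doubling
  would force conjugation to be trivial on the copy of the complex numbers, where it is not
  (\<open>hurwitz\<close>). Conversely the same formula, applied to \<open>B \<times> B\<close>, builds algebras of these dimensions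
  from the reals (\<open>cayley_dickson_composition\<close>), and a linear isometry carries them over to \<open>\<real>\<^sup>n\<close>.

  For the approximation constant, each of the \<open>n\<^sup>2\<close> fibres \<open>X $ i $ j\<close> has norm at most the spectral
  norm, whence \<open>\<parallel>X\<parallel>\<^sub>F \<le> n \<parallel>X\<parallel>\<^sub>2\<close>. Equality makes all fibres as long as possible. A contraction that
  preserves the length of every vector of an orthonormal basis is an isometry
  (\<open>contraction_isometric_on_Basis\<close>); used once in each of the first two arguments, this turns
  an extremal tensor into a multiple of an orthogonal one (\<open>norm_contract_eq_if_extremal\<close>).
\<close>

section \<open>Unital composition algebras\<close>

text \<open>
  For a unit vector \<open>e\<close> this fixes \<open>e\<close> and negates its orthogonal complement; with \<open>e\<close> the unit
  element of a composition algebra it is the conjugation of that algebra.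
\<close>

definition reflect_conj :: "'a::real_inner \<Rightarrow> 'a \<Rightarrow> 'a"
  where "reflect_conj e x = (2 * (x \<bullet> e)) *\<^sub>R e - x"

locale unital_composition =
  fixes mult :: "'a::euclidean_space \<Rightarrow> 'a \<Rightarrow> 'a"  (infixl "\<star>" 70)
    and e :: 'a
  assumes bilinear_mult: "bilinear (\<star>)"
    and norm_mult: "norm (x \<star> y) = norm x * norm y"
    and left_unit [simp]: "e \<star> x = x"
    and right_unit [simp]: "x \<star> e = x"
begin

abbreviation cj :: "'a \<Rightarrow> 'a"  where "cj \<equiv> reflect_conj e"

lemmas mult_linear =
  bilinear_ladd[OF bilinear_mult] bilinear_radd[OF bilinear_mult]
  bilinear_lsub[OF bilinear_mult] bilinear_rsub[OF bilinear_mult]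
  bilinear_lneg[OF bilinear_mult] bilinear_rneg[OF bilinear_mult]
  bilinear_lmul[OF bilinear_mult] bilinear_rmul[OF bilinear_mult]
  bilinear_lzero[OF bilinear_mult] bilinear_rzero[OF bilinear_mult]

lemma unit_inner [simp]: "e \<bullet> e = 1"
proof -
  obtain b :: 'a where "b \<in> Basis" using nonempty_Basis by blast
  then have "norm b = 1" by simp
  then have "norm e = 1" using norm_mult[of e b] by simp
  then show ?thesis by (simp add: norm_eq_1)
qed

lemma inner_mult_same: "(x \<star> y) \<bullet> (x \<star> y) = (x \<bullet> x) * (y \<bullet> y)"
  by (simp add: norm_mult power_mult_distrib flip: power2_norm_eq_inner)

lemma inner_mult_right_factor: "(x \<star> y) \<bullet> (z \<star> y) = (x \<bullet> z) * (y \<bullet> y)"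
  using inner_mult_same[of "x + z" y] inner_mult_same[of x y] inner_mult_same[of z y]
  by (simp add: mult_linear inner_add_left inner_add_right algebra_simps inner_commute[of z x]
      inner_commute[of "z \<star> y" "x \<star> y"])

text \<open>
  The squared form of \<open>norm_mult\<close>, polarised in both factors. All the algebraic laws below come
  from specialising some of the four vectors to the unit or to orthogonal ones.
\<close>

lemma inner_mult_exchange:
  "(x \<star> y) \<bullet> (z \<star> w) + (x \<star> w) \<bullet> (z \<star> y) = 2 * (x \<bullet> z) * (y \<bullet> w)"
  using inner_mult_right_factor[of x "y + w" z] inner_mult_right_factor[of x y z]
    inner_mult_right_factor[of x w z]
  by (simp add: mult_linear inner_add_left inner_add_right algebra_simps inner_commute[of w y])

text \<open>
  Exchange with one argument equal to the unit: multiplication by \<open>x\<close> has multiplication by the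
  conjugate of \<open>x\<close> as its adjoint.
\<close>

lemma adjoint_left: "(x \<star> y) \<bullet> z = y \<bullet> (cj x \<star> z)"
  using inner_mult_exchange[of x y e z]
  by (simp add: reflect_conj_def mult_linear inner_diff_right inner_commute[of y "x \<star> z"])

lemma adjoint_right: "(x \<star> y) \<bullet> z = x \<bullet> (z \<star> cj y)"
  using inner_mult_exchange[of x y z e]
  by (simp add: reflect_conj_def mult_linear inner_diff_right algebra_simps)

lemma cj_involution [simp]: "cj (cj x) = x"
  by (simp add: reflect_conj_def inner_diff_left)

lemma cj_add: "cj (x + y) = cj x + cj y" and cj_diff: "cj (x - y) = cj x - cj y"
  and cj_minus: "cj (- x) = - cj x"
  by (simp_all add: reflect_conj_def inner_add_left inner_diff_left algebra_simps)

lemma inner_cj: "cj x \<bullet> y = x \<bullet> cj y"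
  by (simp add: reflect_conj_def inner_diff_left inner_diff_right inner_commute[of e y])

lemma cj_perp: "x \<bullet> e = 0 \<Longrightarrow> cj x = - x"
  by (simp add: reflect_conj_def)

lemma cj_mult: "cj (x \<star> y) = cj y \<star> cj x"
proof -
  have "cj (x \<star> y) \<bullet> z = (cj y \<star> cj x) \<bullet> z" for z
  proof -
    have "cj (x \<star> y) \<bullet> z = y \<bullet> (cj x \<star> cj z)"
      by (simp add: inner_cj adjoint_left)
    also have "\<dots> = (y \<star> z) \<bullet> cj x"
      by (simp add: adjoint_right)
    also have "\<dots> = (cj y \<star> cj x) \<bullet> z"
      by (subst adjoint_left) (rule inner_commute)
    finally show ?thesis .
  qed
  then show ?thesis by (subst vector_eq_rdot[symmetric]) blast
qed

text \<open>
  The exchange law freed from its fourth vector by adjunction. When \<open>x\<close> and \<open>z\<close> are orthogonal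
  the right-hand side vanishes, and the law becomes a rule for moving one factor past another.
\<close>

lemma left_exchange: "cj x \<star> (z \<star> y) + cj z \<star> (x \<star> y) = (2 * (x \<bullet> z)) *\<^sub>R y"
proof -
  have "(cj x \<star> (z \<star> y) + cj z \<star> (x \<star> y)) \<bullet> w = ((2 * (x \<bullet> z)) *\<^sub>R y) \<bullet> w" for w
    using inner_mult_exchange[of z y x w]
    by (simp add: inner_add_left adjoint_left[of "cj _"] inner_commute[of z x]
        inner_commute[of "z \<star> w" "x \<star> y"])
  then show ?thesis by (subst vector_eq_rdot[symmetric]) blast
qed

lemma right_exchange: "(y \<star> z) \<star> cj x + (y \<star> x) \<star> cj z = (2 * (x \<bullet> z)) *\<^sub>R y"
proof -
  have "cj (cj (cj x) \<star> (cj z \<star> cj y) + cj (cj z) \<star> (cj x \<star> cj y))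
      = cj ((2 * (cj x \<bullet> cj z)) *\<^sub>R cj y)"
    by (simp only: left_exchange)
  then show ?thesis
    by (simp add: cj_add cj_mult inner_cj) (simp add: reflect_conj_def algebra_simps inner_diff_left)
qed

section \<open>Doubling a subalgebra\<close>

definition subalgebra :: "'a set \<Rightarrow> bool"
  where "subalgebra B \<longleftrightarrow> subspace B \<and> e \<in> B \<and> (\<forall>x\<in>B. \<forall>y\<in>B. x \<star> y \<in> B)"

definition unit_normal :: "'a \<Rightarrow> 'a set \<Rightarrow> bool"
  where "unit_normal i B \<longleftrightarrow> norm i = 1 \<and> (\<forall>x\<in>B. i \<bullet> x = 0)"

definition double :: "'a set \<Rightarrow> 'a \<Rightarrow> 'a set"
  where "double B i = {a + b \<star> i | a b. a \<in> B \<and> b \<in> B}"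

lemma cj_closed: "subalgebra B \<Longrightarrow> x \<in> B \<Longrightarrow> cj x \<in> B"
  by (auto simp: subalgebra_def reflect_conj_def subspace_diff subspace_scale)

context
  fixes B i
  assumes B: "subalgebra B" and i: "unit_normal i B"
begin

lemma normal_perp: "x \<in> B \<Longrightarrow> i \<bullet> x = 0" "x \<in> B \<Longrightarrow> x \<bullet> i = 0"
  using i by (auto simp: unit_normal_def inner_commute)

lemma cj_normal: "cj i = - i"
  using B normal_perp by (auto intro!: cj_perp simp: subalgebra_def)

lemma mult_closed: "x \<in> B \<Longrightarrow> y \<in> B \<Longrightarrow> x \<star> y \<in> B"
  using B by (simp add: subalgebra_def)

lemma translate_perp: "b \<in> B \<Longrightarrow> a \<in> B \<Longrightarrow> (b \<star> i) \<bullet> a = 0"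
  by (simp add: adjoint_left normal_perp mult_closed cj_closed[OF B])

lemma normal_square: "(x \<star> i) \<star> i = - x"
proof -
  have "- ((x \<star> i) \<star> i) - (x \<star> i) \<star> i = 2 *\<^sub>R x"
    using right_exchange[of x i i] i by (simp add: cj_normal mult_linear unit_normal_def norm_eq_1)
  then have "- (2 *\<^sub>R ((x \<star> i) \<star> i)) = 2 *\<^sub>R x"
    by (simp add: scaleR_2)
  then have "2 *\<^sub>R ((x \<star> i) \<star> i) = 2 *\<^sub>R (- x)"
    by (metis minus_minus scaleR_minus_right)
  then show ?thesis by (simp only: scaleR_cancel_left) simp
qed

text \<open>
  Both \<open>i\<close> and \<open>b i\<close> are orthogonal to the unit, so conjugation negates them; being an
  anti-automorphism, it reverses the product.
\<close>

lemma normal_mult: "b \<in> B \<Longrightarrow> i \<star> b = cj b \<star> i"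
proof -
  assume b: "b \<in> B"
  have "e \<in> B" using B by (simp add: subalgebra_def)
  then have "cj (cj b \<star> i) = - (cj b \<star> i)"
    by (intro cj_perp translate_perp cj_closed[OF B] b)
  then show ?thesis by (simp add: cj_mult cj_normal mult_linear)
qed

text \<open>
  This and the next two laws compute the product on \<open>B + B i\<close> from the exchange laws. The inner
  product on their right-hand side is zero, because it pairs an element of \<open>B\<close> with \<open>i\<close> or with an
  element of \<open>B i\<close>.
\<close>

lemma mult_translate:
  assumes a: "a \<in> B" and b: "b \<in> B"
  shows "a \<star> (b \<star> i) = (b \<star> a) \<star> i"
proof -
  have "a \<star> (i \<star> cj b) = i \<star> (cj a \<star> cj b)"
    using left_exchange[of "cj a" i "cj b"] normal_perp cj_closed[OF B a]
    by (simp add: cj_normal mult_linear)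
  then show ?thesis
    using normal_mult[of "cj b"] normal_mult[of "cj (b \<star> a)"] a b
    by (simp add: cj_closed[OF B] mult_closed cj_mult)
qed

lemma translate_mult:
  assumes a: "a \<in> B" and b: "b \<in> B"
  shows "(a \<star> i) \<star> b = (a \<star> cj b) \<star> i"
  using right_exchange[of a i "cj b"] normal_perp cj_closed[OF B b]
  by (simp add: cj_normal mult_linear)

lemma translate_mult_translate:
  assumes a: "a \<in> B" and b: "b \<in> B"
  shows "(a \<star> i) \<star> (b \<star> i) = - (cj b \<star> a)"
proof -
  have "e \<in> B" using B by (simp add: subalgebra_def)
  then have "cj (a \<star> i) = - (a \<star> i)"
    by (intro cj_perp translate_perp a)
  then show ?thesis
    using left_exchange[of "- (a \<star> i)" b i] translate_perp[OF a b]
    by (simp add: cj_minus mult_linear normal_square add_eq_0_iff2)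
qed

lemma double_subalgebra: "subalgebra (double B i)"
proof -
  have s: "subspace B" and e: "e \<in> B" using B by (auto simp: subalgebra_def)
  have "double B i = {x + y | x y. x \<in> B \<and> y \<in> (\<lambda>b. b \<star> i) ` B}"
    by (auto simp: double_def)
  moreover have "linear (\<lambda>b. b \<star> i)" using bilinear_mult by (simp add: bilinear_def)
  ultimately have "subspace (double B i)"
    using s by (simp add: subspace_sums linear_subspace_image)
  moreover have "e \<in> double B i"
    using e subspace_0[OF s] by (force simp: double_def mult_linear)
  moreover have "x \<star> y \<in> double B i" if xy: "x \<in> double B i" "y \<in> double B i" for x y
  proof -
    obtain a b where x: "a \<in> B" "b \<in> B" "x = a + b \<star> i"
      using xy(1) unfolding double_def by blast
    obtain c d where y: "c \<in> B" "d \<in> B" "y = c + d \<star> i"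
      using xy(2) unfolding double_def by blast
    note * = x(1,2) y(1,2)
    then have "x \<star> y = (a \<star> c - cj d \<star> b) + (d \<star> a + b \<star> cj c) \<star> i"
      by (simp add: mult_linear mult_translate translate_mult translate_mult_translate x(3) y(3))
    moreover have "a \<star> c - cj d \<star> b \<in> B" "d \<star> a + b \<star> cj c \<in> B"
      using * s by (auto intro!: subspace_add subspace_diff mult_closed cj_closed[OF B])
    ultimately show ?thesis by (auto simp: double_def)
  qed
  ultimately show ?thesis by (simp add: subalgebra_def)
qed

lemma subset_double: "B \<subseteq> double B i"
  using B by (force simp: double_def subalgebra_def mult_linear dest: subspace_0)

lemma translate_in_double: "b \<in> B \<Longrightarrow> b \<star> i \<in> double B i"
  using B by (force simp: double_def subalgebra_def dest: subspace_0)

lemma normal_in_double: "i \<in> double B i"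
  using translate_in_double[of e] B by (simp add: subalgebra_def)

lemma translate_cancel: "x \<star> i = y \<star> i \<Longrightarrow> x = y"
proof -
  assume "x \<star> i = y \<star> i"
  then have "(x \<star> i) \<star> i = (y \<star> i) \<star> i" by (rule arg_cong)
  then show "x = y" unfolding normal_square by simp
qed

lemma dim_double: "dim (double B i) = 2 * dim B"
proof -
  have s: "subspace B" using B by (auto simp: subalgebra_def)
  let ?T = "(\<lambda>b. b \<star> i) ` B"
  have l: "linear (\<lambda>b. b \<star> i)" using bilinear_mult by (simp add: bilinear_def)
  have "inj (\<lambda>b. b \<star> i)" by (rule injI) (rule translate_cancel)
  then have "dim ?T = dim B" using l by (intro dim_image_eq) (auto intro: inj_on_subset)
  moreover have "B \<inter> ?T = {0}"
  proof -
    have "x = 0" if "x \<in> B" "x \<in> ?T" for x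
      using that translate_perp[of _ x] by force
    moreover have "0 \<in> B" by (rule subspace_0[OF s])
    moreover have "0 \<in> ?T"
      by (rule image_eqI[of _ _ 0]) (simp_all add: mult_linear subspace_0[OF s])
    ultimately show ?thesis by blast
  qed
  moreover have "double B i = {x + y | x y. x \<in> B \<and> y \<in> ?T}"
    by (auto simp: double_def)
  ultimately show ?thesis
    using dim_sums_Int[OF s linear_subspace_image[OF l s]] by simp
qed

text \<open>
  In the exchange law for \<open>a\<close>, \<open>c\<close>, \<open>b i\<close>, \<open>d i\<close> the right-hand side vanishes, since \<open>a\<close> is
  orthogonal to \<open>b i\<close>. By the rules for products on \<open>B + B i\<close> and by adjunction, what remains says
  that the two ways of bracketing \<open>d a c\<close> have the same inner product with every \<open>b\<close> in \<open>B\<close>.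
\<close>

lemma normal_imp_associative:
  assumes a: "a \<in> B" and c: "c \<in> B" and d: "d \<in> B"
  shows "d \<star> (a \<star> c) = (d \<star> a) \<star> c"
proof -
  have "(d \<star> (a \<star> c)) \<bullet> b = ((d \<star> a) \<star> c) \<bullet> b" if b: "b \<in> B" for b
  proof -
    have "(a \<star> c) \<bullet> ((b \<star> i) \<star> (d \<star> i)) + (a \<star> (d \<star> i)) \<bullet> ((b \<star> i) \<star> c)
        = 2 * (a \<bullet> (b \<star> i)) * (c \<bullet> (d \<star> i))"
      by (rule inner_mult_exchange)
    also have "\<dots> = 0"
      using translate_perp[OF b a] by (simp add: inner_commute)
    finally have "(a \<star> c) \<bullet> (cj d \<star> b) = ((d \<star> a) \<star> i) \<bullet> ((b \<star> cj c) \<star> i)"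
      using a b c d by (simp add: translate_mult_translate mult_translate translate_mult)
    also have "\<dots> = (d \<star> a) \<bullet> (b \<star> cj c)"
      using i by (simp add: inner_mult_right_factor unit_normal_def norm_eq_1)
    finally show ?thesis by (simp only: adjoint_left[of d "a \<star> c"] adjoint_right[of "d \<star> a" c])
  qed
  moreover have "d \<star> (a \<star> c) - (d \<star> a) \<star> c \<in> B"
    using B a c d by (auto intro!: subspace_diff mult_closed simp: subalgebra_def)
  ultimately have "(d \<star> (a \<star> c) - (d \<star> a) \<star> c) \<bullet> (d \<star> (a \<star> c) - (d \<star> a) \<star> c) = 0"
    by (simp add: inner_diff_left)
  then show ?thesis by simp
qed

text \<open>
  The rule \<open>a (b i) = (b a) i\<close> of \<open>mult_translate\<close> swaps \<open>a\<close> and \<open>b\<close>; associativity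
  would give \<open>(a b) i\<close> instead.
\<close>

lemma double_associative_imp_commutative:
  assumes "\<And>x y z. x \<in> double B i \<Longrightarrow> y \<in> double B i \<Longrightarrow> z \<in> double B i \<Longrightarrow> x \<star> (y \<star> z) = (x \<star> y) \<star> z"
    and "a \<in> B" "b \<in> B"
  shows "a \<star> b = b \<star> a"
proof (rule translate_cancel)
  have "(a \<star> b) \<star> i = a \<star> (b \<star> i)"
    using assms normal_in_double subset_double by (simp add: subset_iff)
  also have "\<dots> = (b \<star> a) \<star> i" using assms by (simp add: mult_translate)
  finally show "(a \<star> b) \<star> i = (b \<star> a) \<star> i" .
qed

lemma double_commutative_imp_cj_trivial:
  assumes "\<And>x y. x \<in> double B i \<Longrightarrow> y \<in> double B i \<Longrightarrow> x \<star> y = y \<star> x" and "a \<in> B"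
  shows "cj a = a"
proof (rule translate_cancel)
  have "cj a \<star> i = i \<star> a" using assms by (simp add: normal_mult)
  also have "\<dots> = a \<star> i"
    using assms normal_in_double subset_double by (simp add: subset_iff)
  finally show "cj a \<star> i = a \<star> i" .
qed

lemma not_cj_trivial_double: "cj i \<noteq> i"
proof
  assume "cj i = i"
  then have "i \<bullet> (- i) = i \<bullet> i" using cj_normal by simp
  then show False using i by (simp add: unit_normal_def norm_eq_1)
qed

end

lemma exists_unit_normal:
  assumes B: "subalgebra B" and d: "dim B \<noteq> DIM('a)"
  obtains i where "unit_normal i B"
proof -
  have "dim B < DIM('a)" using d dim_subset_UNIV[of B] by linarith
  then obtain x where x: "x \<noteq> 0" "\<And>y. y \<in> span B \<Longrightarrow> orthogonal x y"
    by (rule orthogonal_to_subspace_exists) blast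
  then have "unit_normal (x /\<^sub>R norm x) B"
    by (auto simp: unit_normal_def orthogonal_def span_base)
  then show ?thesis by (rule that)
qed

text \<open>
  The chain real line, \<open>C\<close>, \<open>H\<close>, \<open>Oct\<close> of successive doubles exhausts the algebra at one of the
  four steps. If not, there is a unit vector orthogonal to \<open>Oct\<close>, and the laws descend along the
  chain: \<open>Oct\<close> is associative, so \<open>H\<close> is commutative, so conjugation is trivial on \<open>C\<close>. But it
  negates the vector \<open>i\<close> of \<open>C\<close>.
\<close>

theorem hurwitz: "DIM('a) \<in> {1, 2, 4, 8}"
proof (rule ccontr)
  assume no: "DIM('a) \<notin> {1, 2, 4, 8}"
  have "e \<noteq> 0" by (metis inner_zero_left unit_inner zero_neq_one)
  have "x \<star> y \<in> span {e}" if "x \<in> span {e}" "y \<in> span {e}" for x y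
    using that by (auto simp: span_singleton mult_linear)
  then have R: "subalgebra (span {e})"
    by (simp add: subalgebra_def span_base)
  have dR: "dim (span {e}) = 1" using \<open>e \<noteq> 0\<close> by (simp add: dim_insert)
  obtain i where i: "unit_normal i (span {e})"
    using exists_unit_normal[OF R] dR no by auto
  define C where "C = double (span {e}) i"
  have C: "subalgebra C" and dC: "dim C = 2"
    using double_subalgebra[OF R i] dim_double[OF R i] dR by (auto simp: C_def)
  obtain j where j: "unit_normal j C"
    using exists_unit_normal[OF C] dC no by auto
  define H where "H = double C j"
  have H: "subalgebra H" and dH: "dim H = 4"
    using double_subalgebra[OF C j] dim_double[OF C j] dC by (auto simp: H_def)
  obtain k where k: "unit_normal k H"
    using exists_unit_normal[OF H] dH no by auto
  define Oct where "Oct = double H k"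
  have Oct: "subalgebra Oct" and dO: "dim Oct = 8"
    using double_subalgebra[OF H k] dim_double[OF H k] dH by (auto simp: Oct_def)
  obtain l where l: "unit_normal l Oct"
    using exists_unit_normal[OF Oct] dO no by auto
  have "x \<star> (y \<star> z) = (x \<star> y) \<star> z" if "x \<in> Oct" "y \<in> Oct" "z \<in> Oct" for x y z
    using normal_imp_associative[OF Oct l] that by blast
  then have "x \<star> y = y \<star> x" if "x \<in> H" "y \<in> H" for x y
    using double_associative_imp_commutative[OF H k] that unfolding Oct_def by blast
  then have "cj x = x" if "x \<in> C" for x
    using double_commutative_imp_cj_trivial[OF C j] that unfolding H_def by blast
  then show False
    using not_cj_trivial_double[OF R i] normal_in_double[OF R i] unfolding C_def by blast
qed

end

section \<open>Composition algebras of dimensions 1, 2, 4 and 8\<close>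

text \<open>
  The pair \<open>(a, b)\<close> stands for \<open>a + b i\<close> in a double, and the formula is the product computed there.
\<close>

definition cayley_dickson :: "('a::real_inner \<Rightarrow> 'a \<Rightarrow> 'a) \<Rightarrow> 'a \<Rightarrow> 'a \<times> 'a \<Rightarrow> 'a \<times> 'a \<Rightarrow> 'a \<times> 'a"
  where "cayley_dickson m e x y =
    (m (fst x) (fst y) - m (reflect_conj e (snd y)) (snd x),
     m (snd y) (fst x) + m (snd x) (reflect_conj e (fst y)))"

context unital_composition
begin

lemma cj_scaleR: "cj (c *\<^sub>R x) = c *\<^sub>R cj x"
  by (simp add: reflect_conj_def algebra_simps)

lemma cj_unit [simp]: "cj e = e" and cj_zero [simp]: "cj 0 = 0"
  by (simp_all add: reflect_conj_def scaleR_2)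

text \<open>
  Expanding the squared norm of a product of pairs gives the four expected terms and two cross
  terms. By adjunction the cross terms are the inner products of \<open>d (a c)\<close> and of \<open>(d a) c\<close> with
  \<open>b\<close>, with opposite signs, so associativity cancels them.
\<close>

lemma cayley_dickson_composition:
  assumes assoc: "\<And>x y z. x \<star> (y \<star> z) = (x \<star> y) \<star> z"
  shows "unital_composition (cayley_dickson (\<star>) e) (e, 0)"
proof
  show "bilinear (cayley_dickson (\<star>) e)"
    by (auto simp: bilinear_def linear_iff cayley_dickson_def mult_linear cj_add cj_scaleR
        algebra_simps scaleR_diff_right)
  show "norm (cayley_dickson (\<star>) e x y) = norm x * norm y" for x y
  proof -
    obtain a b where x: "x = (a, b)" by (cases x)
    obtain c d where y: "y = (c, d)" by (cases y)
    have cross: "(a \<star> c) \<bullet> (cj d \<star> b) = (d \<star> a) \<bullet> (b \<star> cj c)"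
    proof -
      have "(a \<star> c) \<bullet> (cj d \<star> b) = (d \<star> (a \<star> c)) \<bullet> b" by (rule adjoint_left[symmetric])
      also have "\<dots> = (d \<star> a) \<bullet> (b \<star> cj c)" unfolding assoc by (rule adjoint_right)
      finally show ?thesis .
    qed
    have "cayley_dickson (\<star>) e x y \<bullet> cayley_dickson (\<star>) e x y
        = (a \<star> c) \<bullet> (a \<star> c) + (cj d \<star> b) \<bullet> (cj d \<star> b) - 2 * ((a \<star> c) \<bullet> (cj d \<star> b))
        + ((d \<star> a) \<bullet> (d \<star> a) + (b \<star> cj c) \<bullet> (b \<star> cj c) + 2 * ((d \<star> a) \<bullet> (b \<star> cj c)))"
      by (simp add: x y cayley_dickson_def inner_diff_left inner_diff_right inner_add_left inner_add_right
          inner_commute[of "cj d \<star> b" "a \<star> c"] inner_commute[of "b \<star> cj c" "d \<star> a"])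
    also have "\<dots> = (x \<bullet> x) * (y \<bullet> y)"
      unfolding cross by (simp add: x y inner_mult_same inner_cj algebra_simps)
    finally show ?thesis by (simp add: norm_eq_sqrt_inner real_sqrt_mult)
  qed
qed (simp_all add: cayley_dickson_def mult_linear)

lemma cayley_dickson_commutative:
  assumes "\<And>x y. x \<star> y = y \<star> x" and "\<And>x. cj x = x"
  shows "cayley_dickson (\<star>) e x y = cayley_dickson (\<star>) e y x"
  by (simp add: cayley_dickson_def assms(2) assms(1)[of "fst x"] assms(1)[of "snd x"] add.commute)

lemma cayley_dickson_associative:
  assumes assoc: "\<And>x y z. x \<star> (y \<star> z) = (x \<star> y) \<star> z" and comm: "\<And>x y. x \<star> y = y \<star> x"
  shows "cayley_dickson (\<star>) e x (cayley_dickson (\<star>) e y z)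
    = cayley_dickson (\<star>) e (cayley_dickson (\<star>) e x y) z"
proof -
  have lcomm: "x \<star> (y \<star> z) = y \<star> (x \<star> z)" for x y z
    by (simp only: assoc comm[of x y])
  show ?thesis
    by (simp add: cayley_dickson_def mult_linear cj_add cj_diff cj_mult assoc[symmetric] comm lcomm)
qed

end

interpretation real_composition: unital_composition "(*)" "1 :: real"
  by unfold_locales (auto simp: bilinear_times abs_mult)

abbreviation "complex_mult \<equiv> cayley_dickson (*) (1 :: real)"
abbreviation "quaternion_mult \<equiv> cayley_dickson complex_mult (1, 0)"
abbreviation "octonion_mult \<equiv> cayley_dickson quaternion_mult ((1, 0), 0)"

interpretation complex_composition: unital_composition complex_mult "(1, 0)"
  by (rule real_composition.cayley_dickson_composition) simp

interpretation quaternion_composition: unital_composition quaternion_mult "((1, 0), 0)"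
  by (intro complex_composition.cayley_dickson_composition real_composition.cayley_dickson_associative)
    simp_all

text \<open>
  Conjugation on the reals is the identity, which makes the complex product commutative, hence the
  quaternion product associative, hence the octonion product a composition.
\<close>

interpretation octonion_composition: unital_composition octonion_mult "(((1, 0), 0), 0)"
  by (intro quaternion_composition.cayley_dickson_composition
      complex_composition.cayley_dickson_associative real_composition.cayley_dickson_associative
      real_composition.cayley_dickson_commutative)
    (simp_all add: reflect_conj_def)

section \<open>Orthogonal tensors as norm-multiplicative bilinear maps\<close>

lemma bilinear_norm_sgn:
  assumes "bilinear f"
  shows "norm (f u v) = norm u * norm v * norm (f (sgn u) (sgn v))"
proof -
  have "f u v = f (norm u *\<^sub>R sgn u) (norm v *\<^sub>R sgn v)"
    by (cases "u = 0"; cases "v = 0") (simp_all add: sgn_div_norm)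
  also have "\<dots> = (norm u * norm v) *\<^sub>R f (sgn u) (sgn v)"
    using assms by (simp add: bilinear_lmul bilinear_rmul)
  finally show ?thesis by simp
qed

text \<open>
  Kaplansky's trick. For a unit vector \<open>a\<close> the maps \<open>f a\<close> and \<open>\<lambda>x. f x a\<close> are isometries, hence
  invertible; precomposing the two arguments of \<open>f\<close> with their inverses makes \<open>f a a\<close> a two-sided
  unit without changing norms.
\<close>

lemma composition_imp_unital:
  fixes f :: "'a::euclidean_space \<Rightarrow> 'a \<Rightarrow> 'a"
  assumes bil: "bilinear f" and nrm: "\<And>x y. norm (f x y) = norm x * norm y"
  shows "\<exists>m (e :: 'a). unital_composition m e"
proof -
  obtain a :: 'a where "a \<in> Basis" using nonempty_Basis by blast
  then have a: "norm a = 1" by simp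
  have inverse: "\<exists>g. linear g \<and> (\<forall>x. g (h x) = x) \<and> (\<forall>x. h (g x) = x)"
    if "linear h" "\<And>x. norm (h x) = norm x" for h :: "'a \<Rightarrow> 'a"
  proof -
    have "inj h" using that by (simp add: linear_injective_0) (metis norm_eq_zero)
    then show ?thesis using linear_injective_isomorphism[OF that(1)] by blast
  qed
  have "linear (f a)" "linear (\<lambda>x. f x a)" using bil by (simp_all add: bilinear_def)
  then obtain L R where L: "linear L" "\<And>x. L (f a x) = x" "\<And>x. f a (L x) = x"
    and R: "linear R" "\<And>x. R (f x a) = x" "\<And>x. f (R x) a = x"
    using inverse[of "f a"] inverse[of "\<lambda>x. f x a"] nrm a by auto
  have "norm (L x) = norm x" "norm (R x) = norm x" for x
    using nrm[of a "L x"] nrm[of "R x" a] L R a by simp_all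
  then have "unital_composition (\<lambda>x y. f (R x) (L y)) (f a a)"
    using bil L R
    by unfold_locales (auto simp: bilinear_def nrm intro: linear_compose[unfolded o_def, of L]
        linear_compose[unfolded o_def, of R])
  then show ?thesis by blast
qed

lemma bilinear_contract: "bilinear (\<lambda>u v. X \<times>\<^sub>1 u \<times>\<^sub>1 v)"
  for X :: "real^'p^'m^'n"
  by (auto simp: bilinear_def linear_iff contract1_def vec_eq_iff algebra_simps sum.distrib
      sum_distrib_left)

lemma contract_axis: "X \<times>\<^sub>1 axis i 1 \<times>\<^sub>1 axis j 1 = X $ i $ j"
  for X :: "real^'p^'m^'n"
  by (simp add: contract1_def axis_def if_distrib[of "\<lambda>c. c *\<^sub>R _"] sum.delta cong: if_cong)

lemma orthogonal_tensor3_iff: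
  "orthogonal_tensor3 X \<longleftrightarrow> (\<forall>u v. norm (X \<times>\<^sub>1 u \<times>\<^sub>1 v) = norm u * norm v)"
proof
  assume *: "orthogonal_tensor3 X"
  show "\<forall>u v. norm (X \<times>\<^sub>1 u \<times>\<^sub>1 v) = norm u * norm v"
  proof (intro allI)
    fix u v
    show "norm (X \<times>\<^sub>1 u \<times>\<^sub>1 v) = norm u * norm v"
      using * bilinear_norm_sgn[OF bilinear_contract, of X u v]
      by (cases "u = 0 \<or> v = 0")
        (auto simp: orthogonal_tensor3_def orthogonal_tensor2_def orthogonal_tensor1_def norm_sgn)
  qed
qed (simp add: orthogonal_tensor3_def orthogonal_tensor2_def orthogonal_tensor1_def)

text \<open>
  The tensor is the table of products of basis vectors, with the algebra identified with \<open>\<real>\<^sup>n\<close> by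
  a linear isometry.
\<close>

lemma composition_imp_orthogonal_tensor3:
  fixes m :: "'a::euclidean_space \<Rightarrow> 'a \<Rightarrow> 'a"
  assumes m: "unital_composition m e" and dim: "DIM('a) = CARD('n::finite)"
  shows "\<exists>X :: real^'n^'n^'n. orthogonal_tensor3 X"
proof -
  interpret unital_composition m e by (rule m)
  have "DIM(real^'n) = DIM('a)" using dim by simp
  then obtain f :: "real^'n \<Rightarrow> 'a" and g :: "'a \<Rightarrow> real^'n"
    where lin: "linear f" "linear g"
    and iso: "\<And>x. norm (f x) = norm x" "\<And>x. norm (g x) = norm x"
    by (rule isomorphisms_UNIV_UNIV) blast
  define X :: "real^'n^'n^'n" where "X = (\<chi> i j. g (m (f (axis i 1)) (f (axis j 1))))"
  have "X \<times>\<^sub>1 u \<times>\<^sub>1 v = g (m (f u) (f v))" for u v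
  proof -
    have lin': "linear (\<lambda>x. g (m (f x) y))" "linear (\<lambda>x. g (m y (f x)))" for y
      using lin
      by (auto simp: linear_iff mult_linear)
    have exp: "h w = (\<Sum>i\<in>UNIV. w $ i *\<^sub>R h (axis i 1))" if "linear h" for h :: "real^'n \<Rightarrow> real^'n" and w
      using linear_sum[OF that, of "\<lambda>i. w $ i *\<^sub>R axis i 1" UNIV] linear_scale[OF that]
      by (simp add: basis_expansion flip: scalar_mult_eq_scaleR)
    show ?thesis
      by (subst exp[OF lin'(2)], subst exp[OF lin'(1)]) (simp add: contract1_def X_def)
  qed
  then have "orthogonal_tensor3 X"
    by (simp add: orthogonal_tensor3_iff iso norm_mult)
  then show ?thesis by blast
qed

lemma exists_orthogonal_tensor3_iff:
  "(\<exists>X :: real^'n^'n^'n. orthogonal_tensor3 X) \<longleftrightarrow> CARD('n) \<in> {1, 2, 4, 8}"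
proof
  assume "\<exists>X :: real^'n^'n^'n. orthogonal_tensor3 X"
  then obtain X :: "real^'n^'n^'n" where "\<And>u v. norm (X \<times>\<^sub>1 u \<times>\<^sub>1 v) = norm u * norm v"
    by (auto simp: orthogonal_tensor3_iff)
  then obtain m and e :: "real^'n" where "unital_composition m e"
    using composition_imp_unital[OF bilinear_contract[of X]] by blast
  from unital_composition.hurwitz[OF this] show "CARD('n) \<in> {1, 2, 4, 8}" by simp
next
  assume "CARD('n) \<in> {1, 2, 4, 8}"
  then consider "CARD('n) = 1" | "CARD('n) = 2" | "CARD('n) = 4" | "CARD('n) = 8" by blast
  then show "\<exists>X :: real^'n^'n^'n. orthogonal_tensor3 X"
  proof cases
    case 1
    then show ?thesis
      by (intro composition_imp_orthogonal_tensor3[OF real_composition.unital_composition_axioms]) simp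
  next
    case 2
    then show ?thesis
      by (intro composition_imp_orthogonal_tensor3[OF complex_composition.unital_composition_axioms]) simp
  next
    case 3
    then show ?thesis
      by (intro composition_imp_orthogonal_tensor3[OF quaternion_composition.unital_composition_axioms]) simp
  next
    case 4
    then show ?thesis
      by (intro composition_imp_orthogonal_tensor3[OF octonion_composition.unital_composition_axioms]) simp
  qed
qed

section \<open>The spectral norm and its extremal tensors\<close>

lemma inner_outer3: "X \<bullet> outer3 u v w = (X \<times>\<^sub>1 u \<times>\<^sub>1 v) \<bullet> w"
proof -
  have "(X \<times>\<^sub>1 u \<times>\<^sub>1 v) \<bullet> w
      = (\<Sum>k\<in>UNIV. \<Sum>j\<in>UNIV. \<Sum>i\<in>UNIV. X $ i $ j $ k * (u $ i * v $ j * w $ k))"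
    by (simp add: inner_vec_def contract1_def sum_distrib_left sum_distrib_right algebra_simps)
  also have "\<dots> = (\<Sum>j\<in>UNIV. \<Sum>i\<in>UNIV. \<Sum>k\<in>UNIV. X $ i $ j $ k * (u $ i * v $ j * w $ k))"
    by (subst sum.swap) (intro sum.cong refl sum.swap)
  also have "\<dots> = X \<bullet> outer3 u v w"
    by (subst sum.swap) (simp add: inner_tensor3 outer3_def)
  finally show ?thesis by simp
qed

text \<open>
  For unit vectors, pair the contraction with its own direction to obtain a value that competes in
  the supremum defining the spectral norm; homogeneity does the rest.
\<close>

lemma norm_contract_le_spectral_norm:
  "norm (X \<times>\<^sub>1 u \<times>\<^sub>1 v) \<le> spectral_norm X * (norm u * norm v)"
proof -
  have unit: "norm (X \<times>\<^sub>1 a \<times>\<^sub>1 b) \<le> spectral_norm X" if "norm a = 1" "norm b = 1" for a b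
  proof (cases "X \<times>\<^sub>1 a \<times>\<^sub>1 b = 0")
    case True
    obtain c :: "real^'a" where "norm c = 1" using vector_choose_size[of 1] by auto
    then show ?thesis using spectral_norm_upper[OF that, of c X] True by (simp add: inner_outer3)
  next
    case False
    let ?z = "X \<times>\<^sub>1 a \<times>\<^sub>1 b"
    have "?z \<bullet> sgn ?z = norm ?z"
      using False by (simp add: sgn_div_norm dot_square_norm power2_eq_square)
    then show ?thesis
      using spectral_norm_upper[OF that, of "sgn ?z" X] False by (simp add: inner_outer3 norm_sgn)
  qed
  show ?thesis
  proof (cases "u = 0 \<or> v = 0")
    case True
    then show ?thesis using bilinear_norm_sgn[OF bilinear_contract, of X u v] by auto
  next
    case False
    then have "norm (X \<times>\<^sub>1 sgn u \<times>\<^sub>1 sgn v) \<le> spectral_norm X"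
      by (intro unit) (auto simp: norm_sgn)
    then show ?thesis
      using bilinear_norm_sgn[OF bilinear_contract, of X u v]
      by (metis mult.commute mult_left_mono mult_nonneg_nonneg norm_ge_zero)
  qed
qed

lemma norm_tensor3_fibres: "(norm X)\<^sup>2 = (\<Sum>(i, j)\<in>UNIV. (norm (X $ i $ j))\<^sup>2)"
  for X :: "real^'p^'m^'n"
proof -
  have "(norm X)\<^sup>2 = (\<Sum>i\<in>UNIV. \<Sum>j\<in>UNIV. (norm (X $ i $ j))\<^sup>2)"
    by (simp add: power2_norm_eq_inner inner_vec_def)
  then show ?thesis by (simp add: sum.cartesian_product)
qed

lemma norm_fibre_le_spectral_norm: "norm (X $ i $ j) \<le> spectral_norm X"
  using norm_contract_le_spectral_norm[of X "axis i 1" "axis j 1"]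
  by (simp add: contract_axis norm_axis_1)

lemma spectral_norm_nonneg: "0 \<le> spectral_norm X"
  using norm_fibre_le_spectral_norm norm_ge_zero order_trans by blast

lemma norm_le_spectral_norm: "norm X \<le> real CARD('n) * spectral_norm X"
  for X :: "real^'n^'n^'n"
proof -
  have "(norm X)\<^sup>2 \<le> (\<Sum>(i, j)\<in>(UNIV :: ('n \<times> 'n) set). (spectral_norm X)\<^sup>2)"
    unfolding norm_tensor3_fibres
    by (intro sum_mono) (auto intro!: power_mono norm_fibre_le_spectral_norm)
  also have "\<dots> = (real CARD('n) * spectral_norm X)\<^sup>2"
    by (simp add: power2_eq_square)
  finally show ?thesis
    by (rule power2_le_imp_le) (simp add: spectral_norm_nonneg)
qed

text \<open>
  The images of two basis vectors \<open>b\<close>, \<open>c\<close> are orthogonal: the contraction bound at \<open>b + c\<close> and at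
  \<open>b - c\<close> limits their inner product from above and from below by 0. So an orthonormal basis is
  mapped to orthogonal vectors of length \<open>s\<close>, and Pythagoras gives the claim.
\<close>

lemma contraction_isometric_on_Basis:
  fixes A :: "'a::euclidean_space \<Rightarrow> 'b::real_inner"
  assumes A: "linear A" and le: "\<And>x. norm (A x) \<le> s * norm x"
    and eq: "\<And>b. b \<in> Basis \<Longrightarrow> norm (A b) = s"
  shows "norm (A x) = s * norm x"
proof -
  obtain b :: 'a where "b \<in> Basis" using nonempty_Basis by blast
  then have s: "s \<ge> 0" using eq by force
  have ortho: "A b \<bullet> A c = 0" if bc: "b \<in> Basis" "c \<in> Basis" "b \<noteq> c" for b c
  proof -
    have sq: "(norm (A x))\<^sup>2 \<le> s\<^sup>2 * (x \<bullet> x)" for x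
      using power_mono[OF le[of x], of 2] by (simp add: power_mult_distrib power2_norm_eq_inner)
    have "A b \<bullet> A b = s\<^sup>2" "A c \<bullet> A c = s\<^sup>2"
      using eq bc by (simp_all add: flip: power2_norm_eq_inner)
    then show ?thesis
      using sq[of "b + c"] sq[of "b - c"] bc
      by (simp add: linear_add[OF A] linear_diff[OF A] power2_norm_eq_inner inner_add_left
          inner_add_right inner_diff_left inner_diff_right inner_Basis inner_commute[of "A c" "A b"])
  qed
  have "A x = A (\<Sum>b\<in>Basis. (x \<bullet> b) *\<^sub>R b)" by (simp add: euclidean_representation)
  also have "\<dots> = (\<Sum>b\<in>Basis. (x \<bullet> b) *\<^sub>R A b)"
    by (simp add: linear_sum[OF A] linear_scale[OF A])
  finally have "(norm (A x))\<^sup>2 = (\<Sum>b\<in>Basis. (norm ((x \<bullet> b) *\<^sub>R A b))\<^sup>2)"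
    by (simp only:) (rule norm_sum_Pythagorean; auto simp: pairwise_def orthogonal_def ortho)
  also have "\<dots> = (\<Sum>b\<in>Basis. s\<^sup>2 * ((x \<bullet> b) * (x \<bullet> b)))"
    by (intro sum.cong) (auto simp: eq power_mult_distrib power2_eq_square)
  also have "\<dots> = (s * norm x)\<^sup>2"
    by (simp add: power_mult_distrib power2_norm_eq_inner euclidean_inner[of x x] sum_distrib_left)
  finally show ?thesis using s by simp
qed

text \<open>
  Equality in \<open>norm_le_spectral_norm\<close> forces equality for each single fibre, that is, for pairs of
  basis vectors. The isometry criterion extends it to arbitrary first arguments with the second a
  basis vector, and a second time to arbitrary second arguments.
\<close>

lemma norm_contract_eq_if_extremal:
  fixes X :: "real^'n^'n^'n"
  assumes X: "norm X = real CARD('n) * spectral_norm X"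
  shows "norm (X \<times>\<^sub>1 u \<times>\<^sub>1 v) = spectral_norm X * (norm u * norm v)"
proof -
  let ?s = "spectral_norm X"
  have fibre: "norm (X $ i $ j) = ?s" for i j
  proof (rule ccontr)
    assume "norm (X $ i $ j) \<noteq> ?s"
    then have "norm (X $ i $ j) < ?s"
      using norm_fibre_le_spectral_norm[of X i j] by simp
    then have "(\<Sum>(i, j)\<in>UNIV. (norm (X $ i $ j))\<^sup>2) < (\<Sum>(i, j)\<in>(UNIV :: ('n \<times> 'n) set). ?s\<^sup>2)"
      by (intro sum_strict_mono_ex1 bexI[of _ "(i, j)"])
        (auto intro!: power_mono power_strict_mono norm_fibre_le_spectral_norm)
    then show False
      unfolding norm_tensor3_fibres[symmetric] X by (simp add: power2_eq_square)
  qed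
  have lin: "linear (\<lambda>u. X \<times>\<^sub>1 u \<times>\<^sub>1 v)" "linear (\<lambda>v. X \<times>\<^sub>1 u \<times>\<^sub>1 v)" for u v
    using bilinear_contract[of X] by (simp_all add: bilinear_def)
  have col: "norm (X \<times>\<^sub>1 u \<times>\<^sub>1 axis j 1) = ?s * norm u" for u j
  proof (rule contraction_isometric_on_Basis[OF lin(1)])
    show "norm (X \<times>\<^sub>1 x \<times>\<^sub>1 axis j 1) \<le> ?s * norm x" for x
      using norm_contract_le_spectral_norm[of X x "axis j 1"] by (simp add: norm_axis_1)
  qed (auto simp: Basis_vec_def contract_axis fibre)
  have "norm (X \<times>\<^sub>1 u \<times>\<^sub>1 v) = ?s * norm u * norm v"
    using lin(2)
    by (rule contraction_isometric_on_Basis)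
      (auto simp: Basis_vec_def col norm_contract_le_spectral_norm mult.assoc)
  then show ?thesis by simp
qed

lemma App3_ge: "1 / real CARD('n::finite) \<le> App3 TYPE('n)"
proof -
  obtain X :: "real^'n^'n^'n" where X: "X \<noteq> 0" "App3 TYPE('n) = spectral_norm X / norm X"
    using App3_attained by blast
  then show ?thesis
    unfolding X(2) using norm_le_spectral_norm[of X] by (simp add: field_simps)
qed

text \<open>
  Both directions rest on the fibres: an extremal tensor divided by its spectral norm is orthogonal,
  and an orthogonal tensor has unit fibres, so its Frobenius norm is \<open>n\<close>, while Cauchy-Schwarz
  bounds its spectral norm by 1.
\<close>

lemma App3_eq_iff_exists_orthogonal:
  "App3 TYPE('n::finite) = 1 / real CARD('n) \<longleftrightarrow> (\<exists>X :: real^'n^'n^'n. orthogonal_tensor3 X)"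
proof
  assume App3: "App3 TYPE('n) = 1 / real CARD('n)"
  obtain X :: "real^'n^'n^'n" where X: "X \<noteq> 0" "App3 TYPE('n) = spectral_norm X / norm X"
    using App3_attained by blast
  let ?s = "spectral_norm X"
  have eq: "norm X = real CARD('n) * ?s"
    using X App3 by (simp add: field_simps)
  then have s: "?s > 0" using X spectral_norm_nonneg[of X] by (auto simp: less_le)
  have "((1 / ?s) *\<^sub>R X) \<times>\<^sub>1 u \<times>\<^sub>1 v = (1 / ?s) *\<^sub>R (X \<times>\<^sub>1 u \<times>\<^sub>1 v)" for u v
    by (simp add: contract1_def vec_eq_iff sum_distrib_left algebra_simps)
  then have "orthogonal_tensor3 ((1 / ?s) *\<^sub>R X)"
    using s by (simp add: orthogonal_tensor3_iff norm_contract_eq_if_extremal[OF eq])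
  then show "\<exists>X :: real^'n^'n^'n. orthogonal_tensor3 X" by blast
next
  assume "\<exists>X :: real^'n^'n^'n. orthogonal_tensor3 X"
  then obtain X :: "real^'n^'n^'n" where X: "\<And>u v. norm (X \<times>\<^sub>1 u \<times>\<^sub>1 v) = norm u * norm v"
    by (auto simp: orthogonal_tensor3_iff)
  have "norm (X $ i $ j) = 1" for i j
    using X[of "axis i 1" "axis j 1"] by (simp add: contract_axis norm_axis_1)
  then have "(norm X)\<^sup>2 = (real CARD('n))\<^sup>2"
    by (simp add: norm_tensor3_fibres case_prod_unfold) (simp add: power2_eq_square)
  then have n: "norm X = real CARD('n)" by simp
  obtain u v w where "norm u = 1" "norm v = 1" "norm w = 1"
    and "spectral_norm X = \<bar>(X \<times>\<^sub>1 u \<times>\<^sub>1 v) \<bullet> w\<bar>"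
    using spectral_norm_attained[of X] by (auto simp: inner_outer3)
  then have "spectral_norm X \<le> 1"
    using Cauchy_Schwarz_ineq2[of "X \<times>\<^sub>1 u \<times>\<^sub>1 v" w] by (simp add: X)
  moreover have "X \<noteq> 0" using n by auto
  ultimately have "App3 TYPE('n) \<le> 1 / real CARD('n)"
    using App3_lower[of X] n by (simp add: divide_right_mono order_trans)
  then show "App3 TYPE('n) = 1 / real CARD('n)" using App3_ge[where 'n='n] by simp
qed

theorem theorem4p2:
  shows "((\<exists>X :: real^'n^'n^'n. orthogonal_tensor3 X) \<longleftrightarrow> CARD('n) \<in> {1, 2, 4, 8})
    \<and> (App3 TYPE('n) = 1 / real CARD('n) \<longleftrightarrow> CARD('n) \<in> {1, 2, 4, 8})
    \<and> (CARD('n) \<notin> {1, 2, 4, 8} \<longrightarrow> App3 TYPE('n) > 1 / real CARD('n))"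
proof -
  have ex: "(\<exists>X :: real^'n^'n^'n. orthogonal_tensor3 X) \<longleftrightarrow> CARD('n) \<in> {1, 2, 4, 8}"
    by (rule exists_orthogonal_tensor3_iff)
  moreover have "App3 TYPE('n) = 1 / real CARD('n) \<longleftrightarrow> CARD('n) \<in> {1, 2, 4, 8}"
    unfolding ex[symmetric] by (rule App3_eq_iff_exists_orthogonal)
  ultimately show ?thesis
    using App3_ge[where 'n='n] by (metis order_le_less)
qed

end
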